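(* For every integer $m\geq 2$ with $m\neq 6$, let $k$ be the unique integer such that $2^k+2^{k-1}\leq m<2^k+2^{k+1}$. Then $$h_2(m)=\frac{2^kh_2(2^k)}{m}+\frac{(m-2^k)h_2(m-2^k)}{m}+\frac{2^k(m-2^k)}{m2^{m-1}}.$$
   Context: A triangular choice multigraph (TCM) $\mathcal{G}$ on a vertex set $V$ is obtained by choosing, for every 3-element subset $\{u,v,w\}\subseteq V$, exactly one of the pairs $uv,uw,vw$ and adding one copy of it as an edge; $m^{\mathcal{G}}_{xy}$ is the multiplicity of $xy$; for a TCM on $[m]$, $w(\mathcal{G},2)=\sum_{xy\in\binom{[m]}{2}}2^{m^{\mathcal{G}}_{xy}}$. A TCM $\mathcal{G}$ on $V$ is 2-recursive if either $|V|\in\{1,2\}$ and $\mathcal{G}$ is empty, or $|V|\geq 3$ and there is a partition $V=V_1\cup V_2$ with $V_1,V_2\neq\emptyset$ such that $\mathcal{G}=\mathcal{G}_1\cup\mathcal{G}_2\cup\mathcal{G}_3$ (union with multiplicities), where $\mathcal{G}_i$ is a 2-recursive TCM on $V_i$ and $\mathcal{G}_3$ consists of: for every triple with $u,v\in V_1$, $w\in V_2$ a copy of $uv$, and for every triple with $u\in V_1$, $v,w\in V_2$ a copy of $vw$. $H_2(m)$ is the maximum of $w(\mathcal{G},2)$ over all 2-recursive TCMs on $[m]$, and $h_2(m)=H_2(m)/(m2^{m-1})$ for $m\geq 1$. *)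

theory Defs
  imports Complex_Main "HOL-Library.Multiset" "HOL-Library.Ramsey"
begin

text \<open>A multigraph is given by its multiset of edges, an edge being a two-element vertex set;
  the multiplicity of \<open>xy\<close> is then \<^term>\<open>count G {x, y}\<close>. The function \<open>c\<close> below picks the pair
  chosen from each triple. The set \<^term>\<open>nsets V n\<close> consists of the \<open>n\<close>-element subsets of \<open>V\<close>.\<close>

definition is_tcm :: "'a set \<Rightarrow> 'a set multiset \<Rightarrow> bool" where
  "is_tcm V G \<longleftrightarrow> finite V \<and>
     (\<exists>c. (\<forall>T \<in> nsets V 3. c T \<in> nsets T 2) \<and> G = image_mset c (mset_set (nsets V 3)))"

text \<open>A triple with two vertices in one part and one in the other is represented by the pair
  inside the one part together with the remaining vertex.\<close>

definition split_edges :: "'a set \<Rightarrow> 'a set \<Rightarrow> 'a set multiset" where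
  "split_edges V1 V2 =
     image_mset (\<lambda>(uv, w). uv) (mset_set (nsets V1 2 \<times> V2)) +
     image_mset (\<lambda>(u, vw). vw) (mset_set (V1 \<times> nsets V2 2))"

inductive two_recursive_tcm :: "'a set \<Rightarrow> 'a set multiset \<Rightarrow> bool" where
  small: "\<lbrakk>is_tcm V G; card V \<in> {1, 2}; G = {#}\<rbrakk> \<Longrightarrow> two_recursive_tcm V G"
| split: "\<lbrakk>is_tcm V G; card V \<ge> 3;
     V = V1 \<union> V2; V1 \<inter> V2 = {}; V1 \<noteq> {}; V2 \<noteq> {};
     two_recursive_tcm V1 G1; two_recursive_tcm V2 G2;
     G = G1 + G2 + split_edges V1 V2\<rbrakk> \<Longrightarrow> two_recursive_tcm V G"

definition tcm_weight2 :: "'a set \<Rightarrow> 'a set multiset \<Rightarrow> nat" where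
  "tcm_weight2 V G = (\<Sum>e \<in> nsets V 2. 2 ^ count G e)"

definition H2 :: "nat \<Rightarrow> nat" where
  "H2 m = Max {tcm_weight2 {1..m} G | G. two_recursive_tcm {1..m} G}"

definition h2 :: "nat \<Rightarrow> real" where
  "h2 m = real (H2 m) / (real m * 2 ^ (m - 1))"

end

theory Submission
  imports Defs
begin

text \<open>Every split of the vertex set contributes \<open>a b\<close> to the weight, so \<open>H2\<close> obeys the recursion
  \<open>H2 m = max (2^b H2 a + 2^a H2 b + a b)\<close> over \<open>a + b = m\<close>. After dividing by \<open>2^(m-1)\<close> this becomes
  \<open>f (a + b) = max (f a + f b + 2 \<psi> a \<psi> b)\<close> with \<open>\<psi> n = n / 2^n\<close>, that is, one maximises the sum of
  \<open>2 \<psi> a \<psi> b\<close> over the inner nodes of a binary tree. By induction the larger part \<open>b\<close> of an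
  optimal split of \<open>m\<close> splits as \<open>s + c\<close> with \<open>s\<close> a power of two, and regrouping the
  subtrees then produces a power of two at the root without losing weight: for \<open>a \<le> s\<close> take
  \<open>s + (a + c)\<close>; for larger \<open>a\<close> the term \<open>2 \<psi> x \<psi> y\<close> decays so fast in \<open>x + y\<close> that gains among the
  smallest subtrees pay for all losses above them. The estimates need \<open>m \<ge> 24\<close>; smaller \<open>m\<close>
  are computed.\<close>

section \<open>The recursion on vertex counts\<close>

function W :: "nat \<Rightarrow> nat" where
  "W m = (if m \<le> 1 then 0
     else Max ((\<lambda>a. 2 ^ (m - a) * W a + 2 ^ a * W (m - a) + a * (m - a)) ` {1..<m}))"
  by auto
termination by (relation "Wellfounded.measure id") auto

declare W.simps [simp del]

lemma W_1 [simp]: "W (Suc 0) = 0"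
  by (simp add: W.simps)

lemma W_rec: "2 \<le> m \<Longrightarrow>
    W m = Max ((\<lambda>a. 2 ^ (m - a) * W a + 2 ^ a * W (m - a) + a * (m - a)) ` {1..<m})"
  by (subst W.simps) simp

text \<open>The split 1 + 1 contributes \<open>1 * 1\<close>, which agrees with the two-vertex base
  case: there the only pair has multiplicity 0 and weight \<open>2 ^ 0\<close>.\<close>

lemma W_2: "W 2 = 1"
proof -
  have "{1..<2::nat} = {1}" by auto
  then show ?thesis by (simp add: W_rec)
qed

lemma W_split_le:
  assumes "1 \<le> a" "1 \<le> b"
  shows "2 ^ b * W a + 2 ^ a * W b + a * b \<le> W (a + b)"
proof -
  have "2 ^ (a + b - a) * W a + 2 ^ a * W (a + b - a) + a * (a + b - a) \<le> W (a + b)"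
    using assms by (subst W_rec[of "a + b"]) (auto intro!: Max_ge image_eqI[of _ _ a])
  then show ?thesis by simp
qed

lemma W_split_attained:
  assumes "2 \<le> m"
  obtains a b where "1 \<le> a" "a \<le> b" "a + b = m" "W m = 2 ^ b * W a + 2 ^ a * W b + a * b"
proof -
  let ?g = "\<lambda>a. 2 ^ (m - a) * W a + 2 ^ a * W (m - a) + a * (m - a)"
  have "Max (?g ` {1..<m}) \<in> ?g ` {1..<m}"
    using assms by (intro Max_in) auto
  then obtain a where a: "1 \<le> a" "a < m" "W m = ?g a"
    using W_rec[OF assms] by auto
  show ?thesis
  proof (cases "a \<le> m - a")
    case True
    then show ?thesis using a by (intro that[of a "m - a"]) auto
  next
    case False
    then show ?thesis using a by (intro that[of "m - a" a]) (auto simp: ac_simps)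
  qed
qed

subsection \<open>The recursion for \<open>H2\<close>\<close>

lemma is_tcm_edges:
  assumes "is_tcm V G" "e \<in># G" shows "e \<in> nsets V 2"
proof -
  obtain c where "finite V" "\<forall>T \<in> nsets V 3. c T \<in> nsets T 2"
      "G = image_mset c (mset_set (nsets V 3))"
    using assms(1) by (auto simp: is_tcm_def)
  then obtain T where "T \<in> nsets V 3" "e \<in> nsets T 2"
    using assms(2) by (auto simp: finite_imp_finite_nsets)
  then show ?thesis using nsets_mono[of T V] by (auto simp: nsets_def)
qed

lemma is_tcm_empty:
  assumes "finite V" "card V \<le> 2" shows "is_tcm V {#}"
  using assms by (simp add: is_tcm_def nsets_eq_empty)

lemma count_image_fst:
  assumes "finite A" "finite B"
  shows "count (image_mset (\<lambda>(x, y). x) (mset_set (A \<times> B))) x = (if x \<in> A then card B else 0)"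
proof -
  have "count (image_mset (\<lambda>(x, y). x) (mset_set (A \<times> B))) x
      = (\<Sum>p \<in> (\<lambda>(x, y). x) -` {x} \<inter> (A \<times> B). 1)"
    using assms by (auto simp: count_image_mset intro!: sum.cong)
  also have "(\<lambda>(x, y). x) -` {x} \<inter> (A \<times> B) = (if x \<in> A then {x} \<times> B else {})" by auto
  finally show ?thesis using assms by (simp add: card_cartesian_product)
qed

lemma count_image_snd:
  assumes "finite A" "finite B"
  shows "count (image_mset (\<lambda>(x, y). y) (mset_set (A \<times> B))) y = (if y \<in> B then card A else 0)"
proof -
  have "count (image_mset (\<lambda>(x, y). y) (mset_set (A \<times> B))) y
      = (\<Sum>p \<in> (\<lambda>(x, y). y) -` {y} \<inter> (A \<times> B). 1)"
    using assms by (auto simp: count_image_mset intro!: sum.cong)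
  also have "(\<lambda>(x, y). y) -` {y} \<inter> (A \<times> B) = (if y \<in> B then A \<times> {y} else {})" by auto
  finally show ?thesis using assms by (simp add: card_cartesian_product)
qed

text \<open>A pair inside one part is chosen once for each vertex of the other part, and a crossing
  pair is never chosen.\<close>

lemma count_split_edges:
  assumes "finite V1" "finite V2"
  shows "count (split_edges V1 V2) e =
    (if e \<in> nsets V1 2 then card V2 else 0) + (if e \<in> nsets V2 2 then card V1 else 0)"
  using assms by (simp add: split_edges_def count_image_fst count_image_snd finite_imp_finite_nsets)

lemma nsets_2_Un:
  assumes "A \<inter> B = {}"
  shows "nsets (A \<union> B) 2 = nsets A 2 \<union> nsets B 2 \<union> (\<lambda>(x, y). {x, y}) ` (A \<times> B)"
proof
  show "nsets (A \<union> B) 2 \<subseteq> nsets A 2 \<union> nsets B 2 \<union> (\<lambda>(x, y). {x, y}) ` (A \<times> B)"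
  proof
    fix e assume "e \<in> nsets (A \<union> B) 2"
    then obtain x y where e: "e = {x, y}" "x \<in> A \<union> B" "y \<in> A \<union> B" "x \<noteq> y"
      by (auto elim: nsets2_E)
    have "{x, y} = {y, x}" by auto
    then show "e \<in> nsets A 2 \<union> nsets B 2 \<union> (\<lambda>(x, y). {x, y}) ` (A \<times> B)"
      using e by (force simp: image_iff)
  qed
  show "nsets A 2 \<union> nsets B 2 \<union> (\<lambda>(x, y). {x, y}) ` (A \<times> B) \<subseteq> nsets (A \<union> B) 2"
    using assms nsets_mono[of A "A \<union> B"] nsets_mono[of B "A \<union> B"] by auto
qed

text \<open>Joining the parts raises every multiplicity inside \<open>V1\<close> by
  \<open>card V2\<close>, so those weights are scaled by \<open>2 ^ card V2\<close>, and
  symmetrically for \<open>V2\<close>. Each crossing pair has multiplicity 0 and adds 1, which gives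
  the product term.\<close>

lemma tcm_weight2_split:
  assumes fin: "finite V1" "finite V2" and disj: "V1 \<inter> V2 = {}"
    and tcm: "is_tcm V1 G1" "is_tcm V2 G2"
  shows "tcm_weight2 (V1 \<union> V2) (G1 + G2 + split_edges V1 V2) =
    2 ^ card V2 * tcm_weight2 V1 G1 + 2 ^ card V1 * tcm_weight2 V2 G2 + card V1 * card V2"
proof -
  let ?G = "G1 + G2 + split_edges V1 V2"
  let ?X = "(\<lambda>(x, y). {x, y}) ` (V1 \<times> V2)"
  have out: "count G1 e = 0" if "e \<notin> nsets V1 2" for e
    using is_tcm_edges[OF tcm(1)] that by (meson count_inI)
  have out2: "count G2 e = 0" if "e \<notin> nsets V2 2" for e
    using is_tcm_edges[OF tcm(2)] that by (meson count_inI)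
  have d12: "nsets V1 2 \<inter> nsets V2 2 = {}" using disj by (auto simp: nsets_2_eq)
  have d3: "(nsets V1 2 \<union> nsets V2 2) \<inter> ?X = {}"
    using disj by (auto simp: nsets_def)
  have "tcm_weight2 (V1 \<union> V2) ?G = (\<Sum>e \<in> nsets V1 2. 2 ^ count ?G e)
      + (\<Sum>e \<in> nsets V2 2. 2 ^ count ?G e) + (\<Sum>e \<in> ?X. 2 ^ count ?G e)"
    unfolding tcm_weight2_def nsets_2_Un[OF disj] using fin d12 d3
    by (simp add: sum.union_disjoint finite_imp_finite_nsets)
  also have "(\<Sum>e \<in> nsets V1 2. (2::nat) ^ count ?G e) = (\<Sum>e \<in> nsets V1 2. 2 ^ card V2 * 2 ^ count G1 e)"
    using d12 by (intro sum.cong refl) (auto simp: count_split_edges fin out2 power_add ac_simps)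
  also have "(\<Sum>e \<in> nsets V2 2. (2::nat) ^ count ?G e) = (\<Sum>e \<in> nsets V2 2. 2 ^ card V1 * 2 ^ count G2 e)"
    using d12 by (intro sum.cong refl) (auto simp: count_split_edges fin out power_add ac_simps)
  also have "(\<Sum>e \<in> ?X. 2 ^ count ?G e) = (\<Sum>e \<in> ?X. 1::nat)"
  proof (intro sum.cong refl)
    fix e assume "e \<in> ?X"
    then have "e \<notin> nsets V1 2" "e \<notin> nsets V2 2" using d3 by auto
    then show "2 ^ count ?G e = (1::nat)" by (simp add: count_split_edges fin out out2)
  qed
  also have "\<dots> = card V1 * card V2"
  proof -
    have "inj_on (\<lambda>(x, y). {x, y}) (V1 \<times> V2)"
      using disj by (auto simp: inj_on_def doubleton_eq_iff)
    then show ?thesis by (simp add: card_image card_cartesian_product)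
  qed
  finally show ?thesis by (simp add: tcm_weight2_def sum_distrib_left)
qed

section \<open>Gluing two choice functions\<close>

lemma nsets_3_Un:
  assumes "A \<inter> B = {}"
  shows "nsets (A \<union> B) 3 = nsets A 3 \<union> nsets B 3 \<union>
    ((\<lambda>(uv, w). insert w uv) ` (nsets A 2 \<times> B) \<union> (\<lambda>(u, vw). insert u vw) ` (A \<times> nsets B 2))"
    (is "?L = ?R")
proof
  show "?R \<subseteq> ?L"
  proof -
    have "insert w e \<in> nsets (A \<union> B) 3" if "e \<in> nsets A 2 \<and> w \<in> B \<or> e \<in> nsets B 2 \<and> w \<in> A" for e w
      using that assms by (auto simp: nsets_def card_insert_if)
    then show ?thesis using nsets_mono[of A "A \<union> B"] nsets_mono[of B "A \<union> B"] by auto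
  qed
  show "?L \<subseteq> ?R"
  proof
    fix T assume T: "T \<in> ?L"
    then have "T \<subseteq> A \<union> B" "finite T" "card T = 3" by (auto simp: nsets_def)
    define X where "X = T \<inter> A"
    define Y where "Y = T \<inter> B"
    have XY: "T = X \<union> Y" "X \<inter> Y = {}" "X \<subseteq> A" "Y \<subseteq> B" "finite X" "finite Y"
      using \<open>T \<subseteq> A \<union> B\<close> \<open>finite T\<close> assms by (auto simp: X_def Y_def)
    then have "card X + card Y = 3" using \<open>card T = 3\<close> card_Un_disjoint by metis
    then consider "card X = 0" "card Y = 3" | "card X = 1" "card Y = 2"
      | "card X = 2" "card Y = 1" | "card X = 3" "card Y = 0" by linarith
    then show "T \<in> ?R"
    proof cases
      case 1
      then have "T \<in> nsets B 3" using XY by (simp add: nsets_def)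
      then show ?thesis by blast
    next
      case 2
      then obtain u where "X = {u}" using card_1_singletonE by blast
      then have "(u, Y) \<in> A \<times> nsets B 2" "T = (\<lambda>(u, vw). insert u vw) (u, Y)"
        using XY 2 by (auto simp: nsets_def)
      then show ?thesis by blast
    next
      case 3
      then obtain w where "Y = {w}" using card_1_singletonE by blast
      then have "(X, w) \<in> nsets A 2 \<times> B" "T = (\<lambda>(uv, w). insert w uv) (X, w)"
        using XY 3 by (auto simp: nsets_def)
      then show ?thesis by blast
    next
      case 4
      then have "T \<in> nsets A 3" using XY by (simp add: nsets_def)
      then show ?thesis by blast
    qed
  qed
qed

text \<open>The two choice functions extend to mixed triples by choosing the pair that lies inside
  one part; this pair is unique because three vertices are distributed as 2 + 1.\<close>

lemma is_tcm_split:
  assumes disj: "V1 \<inter> V2 = {}" and tcm: "is_tcm V1 G1" "is_tcm V2 G2"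
  shows "is_tcm (V1 \<union> V2) (G1 + G2 + split_edges V1 V2)"
proof -
  have fin: "finite V1" "finite V2" using tcm by (auto simp: is_tcm_def)
  obtain c1 where c1: "\<And>T. T \<in> nsets V1 3 \<Longrightarrow> c1 T \<in> nsets T 2"
      "G1 = image_mset c1 (mset_set (nsets V1 3))"
    using tcm(1) by (auto simp: is_tcm_def)
  obtain c2 where c2: "\<And>T. T \<in> nsets V2 3 \<Longrightarrow> c2 T \<in> nsets T 2"
      "G2 = image_mset c2 (mset_set (nsets V2 3))"
    using tcm(2) by (auto simp: is_tcm_def)
  let ?g1 = "\<lambda>(uv, w). insert w uv" and ?g2 = "\<lambda>(u, vw). insert u vw"
  let ?P1 = "nsets V1 2 \<times> V2" and ?P2 = "V1 \<times> nsets V2 2"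
  \<comment> \<open>For a mixed triple with fewer than two vertices in \<open>V1\<close>, the last
    branch returns the two vertices in \<open>V2\<close>.\<close>
  define c where "c T = (if T \<subseteq> V1 then c1 T else if T \<subseteq> V2 then c2 T
    else if card (T \<inter> V1) = 2 then T \<inter> V1 else T \<inter> V2)" for T
  have cV1: "c T = c1 T" if "T \<in> nsets V1 3" for T using that by (auto simp: c_def nsets_def)
  have not_both: "\<not> (T \<subseteq> V1 \<and> T \<subseteq> V2)" if "card T \<noteq> 0" for T
  proof
    assume "T \<subseteq> V1 \<and> T \<subseteq> V2"
    then have "T = {}" using disj by auto
    then show False using that by simp
  qed
  have cV2: "c T = c2 T" if "T \<in> nsets V2 3" for T
    using that not_both[of T] by (simp add: c_def nsets_def)
  have cg1: "c (?g1 p) = (\<lambda>(uv, w). uv) p" if mem: "p \<in> ?P1" for p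
  proof -
    obtain e w where p: "p = (e, w)" "e \<in> nsets V1 2" "w \<in> V2" using mem by auto
    then have "insert w e \<inter> V1 = e" "\<not> insert w e \<subseteq> V1" "\<not> insert w e \<subseteq> V2" "card e = 2"
      using disj not_both[of e] by (auto simp: nsets_def)
    then show ?thesis by (simp add: c_def p del: insert_subset Int_insert_left_if1 Int_insert_left_if0)
  qed
  have cg2: "c (?g2 p) = (\<lambda>(u, vw). vw) p" if mem: "p \<in> ?P2" for p
  proof -
    obtain u e where p: "p = (u, e)" "e \<in> nsets V2 2" "u \<in> V1" using mem by auto
    then have "insert u e \<inter> V2 = e" "insert u e \<inter> V1 = {u}"
        "\<not> insert u e \<subseteq> V1" "\<not> insert u e \<subseteq> V2"
      using disj not_both[of e] by (auto simp: nsets_def)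
    then show ?thesis by (simp add: c_def p del: insert_subset Int_insert_left_if1 Int_insert_left_if0)
  qed
  have finN: "finite (nsets V1 n)" "finite (nsets V2 n)" for n
    using fin finite_imp_finite_nsets by auto
  have inj1: "inj_on ?g1 ?P1"
  proof (rule inj_onI, clarify)
    fix e w e' w' assume "e \<in> nsets V1 2" "w \<in> V2" "e' \<in> nsets V1 2" "w' \<in> V2"
      and eq: "insert w e = insert w' e'"
    then have "insert w e \<inter> V1 = e" "insert w' e' \<inter> V1 = e'"
        "insert w e \<inter> V2 = {w}" "insert w' e' \<inter> V2 = {w'}"
      using disj by (auto simp: nsets_def)
    then show "e = e' \<and> w = w'" using eq by auto
  qed
  have inj2: "inj_on ?g2 ?P2"
  proof (rule inj_onI, clarify)
    fix u e u' e' assume "e \<in> nsets V2 2" "u \<in> V1" "e' \<in> nsets V2 2" "u' \<in> V1"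
      and eq: "insert u e = insert u' e'"
    then have "insert u e \<inter> V2 = e" "insert u' e' \<inter> V2 = e'"
        "insert u e \<inter> V1 = {u}" "insert u' e' \<inter> V1 = {u'}"
      using disj by (auto simp: nsets_def)
    then show "u = u' \<and> e = e'" using eq by auto
  qed
  \<comment> \<open>The four families of triples are pairwise disjoint and both mixed families are
    parametrised injectively, so the multiset of all triples is a sum of four multisets on which
    \<open>c\<close> can be evaluated separately.\<close>
  have "nsets V1 3 \<inter> nsets V2 3 = {}"
    using not_both by (auto simp: nsets_def)
  moreover have "(nsets V1 3 \<union> nsets V2 3) \<inter> (?g1 ` ?P1 \<union> ?g2 ` ?P2) = {}"
  proof -
    have "\<not> insert w e \<subseteq> V1 \<and> \<not> insert w e \<subseteq> V2"
      if "e \<in> nsets V1 2 \<and> w \<in> V2 \<or> e \<in> nsets V2 2 \<and> w \<in> V1" for e w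
      using that disj not_both[of e] by (auto simp: nsets_def)
    then have "T \<notin> nsets V1 3 \<union> nsets V2 3" if "T \<in> ?g1 ` ?P1 \<union> ?g2 ` ?P2" for T
      using that by (auto simp: nsets_def[of _ 3])
    then show ?thesis by blast
  qed
  moreover have "?g1 ` ?P1 \<inter> ?g2 ` ?P2 = {}"
  proof -
    have "insert w e \<noteq> insert u e'"
      if "e \<in> nsets V1 2" "w \<in> V2" "e' \<in> nsets V2 2" "u \<in> V1" for e w e' u
    proof
      assume eq: "insert w e = insert u e'"
      have "insert w e \<inter> V1 = e" "insert u e' \<inter> V1 = {u}" "card e = 2"
        using that disj by (auto simp: nsets_def)
      then show False using eq by auto
    qed
    then show ?thesis by fast
  qed
  ultimately have "mset_set (nsets (V1 \<union> V2) 3) = mset_set (nsets V1 3) + mset_set (nsets V2 3)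
      + (mset_set (?g1 ` ?P1) + mset_set (?g2 ` ?P2))"
    unfolding nsets_3_Un[OF disj] using fin finN by (simp add: mset_set_Union)
  also have "mset_set (?g1 ` ?P1) = image_mset ?g1 (mset_set ?P1)"
    using inj1 by (simp add: image_mset_mset_set)
  also have "mset_set (?g2 ` ?P2) = image_mset ?g2 (mset_set ?P2)"
    using inj2 by (simp add: image_mset_mset_set)
  finally have "image_mset c (mset_set (nsets (V1 \<union> V2) 3)) =
      image_mset c (mset_set (nsets V1 3)) + image_mset c (mset_set (nsets V2 3))
      + (image_mset (\<lambda>p. c (?g1 p)) (mset_set ?P1) + image_mset (\<lambda>p. c (?g2 p)) (mset_set ?P2))"
    by (simp add: multiset.map_comp comp_def)
  also have "image_mset c (mset_set (nsets V1 3)) = G1"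
    unfolding c1(2) using cV1 finN by (intro image_mset_cong) simp
  also have "image_mset c (mset_set (nsets V2 3)) = G2"
    unfolding c2(2) using cV2 finN by (intro image_mset_cong) simp
  also have "image_mset (\<lambda>p. c (?g1 p)) (mset_set ?P1) = image_mset (\<lambda>(uv, w). uv) (mset_set ?P1)"
    using cg1 fin finN by (intro image_mset_cong) simp
  also have "image_mset (\<lambda>p. c (?g2 p)) (mset_set ?P2) = image_mset (\<lambda>(u, vw). vw) (mset_set ?P2)"
    using cg2 fin finN by (intro image_mset_cong) simp
  finally have G: "G1 + G2 + split_edges V1 V2 = image_mset c (mset_set (nsets (V1 \<union> V2) 3))"
    by (simp add: split_edges_def)
  have "c T \<in> nsets T 2" if "T \<in> nsets (V1 \<union> V2) 3" for T
  proof -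
    consider "T \<in> nsets V1 3" | "T \<in> nsets V2 3" | p where "p \<in> ?P1" "T = ?g1 p"
      | p where "p \<in> ?P2" "T = ?g2 p"
      using \<open>T \<in> nsets (V1 \<union> V2) 3\<close> unfolding nsets_3_Un[OF disj] by blast
    then show ?thesis
    proof cases
      case 1 then show ?thesis using c1 cV1 by simp
    next
      case 2 then show ?thesis using c2 cV2 by simp
    next
      case 3 then show ?thesis using cg1[of p] by (auto simp: nsets_def split: prod.splits)
    next
      case 4 then show ?thesis using cg2[of p] by (auto simp: nsets_def split: prod.splits)
    qed
  qed
  with G fin show ?thesis by (auto simp: is_tcm_def)
qed

section \<open>The weights of 2-recursive TCMs bounded and attained by \<open>W\<close>\<close>

lemma two_recursive_tcm_is_tcm: "two_recursive_tcm V G \<Longrightarrow> is_tcm V G"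
  by (erule two_recursive_tcm.cases) auto

lemma tcm_weight2_empty:
  assumes "finite V" shows "tcm_weight2 V {#} = card V choose 2"
proof -
  have "nsets V 2 = {e. e \<subseteq> V \<and> card e = 2}"
    using assms finite_subset by (auto simp: nsets_def)
  then show ?thesis using n_subsets[OF assms, of 2] by (simp add: tcm_weight2_def)
qed

lemma tcm_weight2_empty_eq_W:
  assumes "finite V" "card V \<in> {1, 2}" shows "tcm_weight2 V {#} = W (card V)"
  using assms W_2 by (auto simp: tcm_weight2_empty binomial_eq_0)

lemma tcm_weight2_le_W: "two_recursive_tcm V G \<Longrightarrow> V \<noteq> {} \<and> tcm_weight2 V G \<le> W (card V)"
proof (induction rule: two_recursive_tcm.induct)
  case (small V G)
  then have "finite V" by (simp add: is_tcm_def)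
  then show ?case using small tcm_weight2_empty_eq_W[of V] by auto
next
  case (split V G V1 V2 G1 G2)
  have tcm: "is_tcm V1 G1" "is_tcm V2 G2" using split two_recursive_tcm_is_tcm by auto
  then have fin: "finite V1" "finite V2" by (auto simp: is_tcm_def)
  have "tcm_weight2 V G =
      2 ^ card V2 * tcm_weight2 V1 G1 + 2 ^ card V1 * tcm_weight2 V2 G2 + card V1 * card V2"
    using split tcm_weight2_split[OF fin _ tcm] by simp
  also have "\<dots> \<le> 2 ^ card V2 * W (card V1) + 2 ^ card V1 * W (card V2) + card V1 * card V2"
    using split.IH by (intro add_mono mult_left_mono) auto
  also have "\<dots> \<le> W (card V1 + card V2)"
    using split fin by (intro W_split_le) (auto simp: Suc_le_eq card_gt_0_iff)
  also have "card V1 + card V2 = card V" using split fin by (simp add: card_Un_disjoint)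
  finally show ?case using split by auto
qed

text \<open>An optimal split of the number \<open>card V\<close> is realised by cutting
  \<open>V\<close> into parts of these sizes. Arbitrary vertex sets are needed for the induction,
  since the parts of an interval \<open>{1..m}\<close> cannot both be intervals starting at
  1.\<close>

lemma W_attained:
  assumes "finite V" "V \<noteq> {}"
  shows "\<exists>G. two_recursive_tcm V G \<and> tcm_weight2 V G = W (card V)"
  using assms
proof (induction "card V" arbitrary: V rule: less_induct)
  case less
  have pos: "1 \<le> card V" using less.prems by (simp add: Suc_le_eq card_gt_0_iff)
  show ?case
  proof (cases "card V \<le> 2")
    case True
    with pos have "card V \<in> {1, 2}" by auto
    with True less.prems(1) have "two_recursive_tcm V {#}"
      by (intro two_recursive_tcm.small is_tcm_empty) auto
    with less.prems(1) \<open>card V \<in> {1, 2}\<close> show ?thesis using tcm_weight2_empty_eq_W by blast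
  next
    case False
    then obtain a b where ab: "1 \<le> a" "a \<le> b" "a + b = card V"
        "W (card V) = 2 ^ b * W a + 2 ^ a * W b + a * b"
      using W_split_attained[of "card V"] by auto
    obtain V1 where V1: "V1 \<subseteq> V" "card V1 = a" "finite V1"
      using obtain_subset_with_card_n[of a V] ab(3) by auto
    define V2 where "V2 = V - V1"
    have V2: "V = V1 \<union> V2" "V1 \<inter> V2 = {}" "card V2 = b" "finite V2"
      using V1 ab(3) less.prems(1) by (auto simp: V2_def card_Diff_subset)
    have ne: "V1 \<noteq> {}" "V2 \<noteq> {}" using V1 V2 ab(1,2) by auto
    obtain G1 where G1: "two_recursive_tcm V1 G1" "tcm_weight2 V1 G1 = W a"
      using less.hyps[of V1] V1 ne ab by auto
    obtain G2 where G2: "two_recursive_tcm V2 G2" "tcm_weight2 V2 G2 = W b"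
      using less.hyps[of V2] V2 ne ab by auto
    let ?G = "G1 + G2 + split_edges V1 V2"
    have tcm: "is_tcm V1 G1" "is_tcm V2 G2" using G1 G2 two_recursive_tcm_is_tcm by auto
    have "is_tcm V ?G" using is_tcm_split[OF V2(2) tcm] V2(1) by simp
    then have "two_recursive_tcm V ?G"
      by (rule two_recursive_tcm.split[OF _ _ V2(1,2) ne G1(1) G2(1)]) (use False in auto)
    moreover have "tcm_weight2 V ?G = W (card V)"
      using tcm_weight2_split[OF V1(3) V2(4,2) tcm] by (simp add: V2(1)[symmetric] V1 V2(3) G1 G2 ab(4))
    ultimately show ?thesis by blast
  qed
qed

lemma H2_eq_W:
  assumes "1 \<le> m" shows "H2 m = W m"
proof -
  let ?S = "{tcm_weight2 {1..m} G | G. two_recursive_tcm {1..m} G}"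
  have le: "x \<le> W m" if "x \<in> ?S" for x using that tcm_weight2_le_W by fastforce
  \<comment> \<open>A bounded set of naturals is finite, so the \<open>Max\<close> in
    \<open>H2\<close> is a true maximum.\<close>
  then have "finite ?S" by (meson finite_nat_set_iff_bounded_le)
  moreover have "W m \<in> ?S"
  proof -
    obtain G where "two_recursive_tcm {1..m} G" "tcm_weight2 {1..m} G = W m"
      using W_attained[of "{1..m}"] assms by auto
    then show ?thesis by (intro CollectI exI[of _ G]) simp
  qed
  ultimately show ?thesis unfolding H2_def using le by (intro Max_eqI) auto
qed

subsection \<open>Optimal splits\<close>

definition \<psi> :: "nat \<Rightarrow> real" where
  "\<psi> n = real n / 2 ^ n"

text \<open>This is the \<open>f\<close> of the overview, W(m) / 2^(m-1), written without a
  truncated subtraction. By \<open>h2_eq_val\<close> it equals \<open>m * h2 m\<close> for positive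
  \<open>m\<close>.\<close>

definition val :: "nat \<Rightarrow> real" where
  "val m = 2 * real (W m) / 2 ^ m"

definition split_val :: "nat \<Rightarrow> nat \<Rightarrow> real" where
  "split_val a b = val a + val b + 2 * \<psi> a * \<psi> b"

lemma \<psi>_mult: "\<psi> a * \<psi> b = real (a * b) / 2 ^ (a + b)"
  by (simp add: \<psi>_def power_add)

lemma \<psi>_nonneg [simp]: "0 \<le> \<psi> n"
  by (simp add: \<psi>_def)

lemma split_val_eq:
  "split_val a b = 2 * real (2 ^ b * W a + 2 ^ a * W b + a * b) / 2 ^ (a + b)"
  by (simp add: split_val_def val_def \<psi>_def power_add field_simps)

lemma split_val_commute: "split_val a b = split_val b a"
  by (simp add: split_val_def)

lemma split_val_le: "1 \<le> a \<Longrightarrow> 1 \<le> b \<Longrightarrow> split_val a b \<le> val (a + b)"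
  unfolding split_val_eq val_def
  using W_split_le[of a b] by (intro divide_right_mono mult_left_mono of_nat_mono) auto

lemma val_double_ge:
  assumes "1 \<le> s" shows "2 * val s + 2 * \<psi> s * \<psi> s \<le> val (2 * s)"
  using split_val_le[OF assms assms] unfolding split_val_def mult_2[of s] by simp

lemma split_val_attained:
  assumes "2 \<le> m"
  obtains a b where "1 \<le> a" "a \<le> b" "a + b = m" "val m = split_val a b"
proof -
  obtain a b where "1 \<le> a" "a \<le> b" "a + b = m" "W m = 2 ^ b * W a + 2 ^ a * W b + a * b"
    using W_split_attained[OF assms] .
  then show ?thesis by (intro that[of a b]) (simp_all add: split_val_eq val_def)
qed

section \<open>Inequalities for \<psi>\<close>

text \<open>Raising \<open>s\<close> by one adds \<open>2 ^ a - 1\<close> on the left and the larger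
  \<open>a * 2 ^ s\<close> on the right. Divided by \<open>a * s\<close>, this is the monotonicity
  of (2^n - 1) / n.\<close>

lemma pow2_minus_one_ratio_mono:
  assumes "1 \<le> a" "a \<le> s"
  shows "real s * (2 ^ a - 1) \<le> real a * (2 ^ s - 1)"
  using assms(2)
proof (induction s rule: dec_induct)
  case (step n)
  have "(2::real) ^ a - 1 \<le> 2 ^ n"
    using power_increasing[OF step(1), of "2::real"] by linarith
  also have "\<dots> \<le> real a * 2 ^ n" using assms(1) by simp
  finally show ?case using step by (simp add: algebra_simps)
qed simp

text \<open>The same induction for (2^n + 1) / n. It starts at 2 because the ratio drops from 3 at n
  = 1 to 5/2 at n = 2.\<close>

lemma pow2_plus_one_ratio_mono:
  assumes "2 \<le> a" "a \<le> s"
  shows "real s * (2 ^ a + 1) \<le> real a * (2 ^ s + 1)"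
  using assms(2)
proof (induction s rule: dec_induct)
  case (step n)
  have "(2::real) ^ a + 1 \<le> 2 * 2 ^ n"
    using power_increasing[OF step(1), of "2::real"] one_le_power[of "2::real" n] by linarith
  also have "\<dots> \<le> real a * 2 ^ n" using assms(1) by (intro mult_right_mono) auto
  finally show ?case using step by (simp add: algebra_simps)
qed simp

lemma \<psi>_Suc_le:
  assumes "1 \<le> n" shows "\<psi> (Suc n) \<le> \<psi> n"
  using assms by (simp add: \<psi>_def field_simps)

lemma \<psi>_antimono:
  assumes "1 \<le> a" "a \<le> b" shows "\<psi> b \<le> \<psi> a"
  using assms(2)
proof (induction b rule: dec_induct)
  case (step n)
  then show ?case using \<psi>_Suc_le[of n] assms(1) by simp
qed simp

text \<open>The left side is exactly \<open>\<psi> (b - 1) - \<psi> b\<close>, the last step of the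
  descent from \<open>a\<close> to \<open>b\<close>.\<close>

lemma \<psi>_gap:
  assumes "1 \<le> a" "a < b"
  shows "(real b - 2) / 2 ^ b \<le> \<psi> a - \<psi> b"
proof -
  obtain n where n: "b = Suc n" "a \<le> n" using assms(2) by (cases b) auto
  have "(real b - 2) / 2 ^ b = \<psi> n - \<psi> b"
    by (simp add: n \<psi>_def field_simps)
  also have "\<dots> \<le> \<psi> a - \<psi> b" using \<psi>_antimono[OF assms(1) n(2)] by simp
  finally show ?thesis .
qed

text \<open>Of three parts, the largest should be merged last.\<close>

lemma \<psi>_rotate:
  assumes "1 \<le> a" "a \<le> s"
  shows "\<psi> s * \<psi> c + \<psi> a * \<psi> (s + c) \<le> \<psi> a * \<psi> c + \<psi> s * \<psi> (a + c)"
proof -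
  have "\<psi> a * \<psi> c + \<psi> s * \<psi> (a + c) - (\<psi> s * \<psi> c + \<psi> a * \<psi> (s + c)) =
      real c * (real a * (2 ^ s - 1) - real s * (2 ^ a - 1)) / 2 ^ (a + s + c)"
    by (simp add: \<psi>_def power_add field_simps)
  also have "\<dots> \<ge> 0" using pow2_minus_one_ratio_mono[OF assms] by simp
  finally show ?thesis by simp
qed

lemma \<psi>_regroup:
  assumes "2 \<le> s" "2 \<le> e" "2 \<le> c" "e \<le> s \<and> c \<le> s \<or> s \<le> e \<and> s \<le> c"
  shows "\<psi> s * \<psi> e + \<psi> s * \<psi> c + \<psi> (s + e) * \<psi> (s + c)
    \<le> \<psi> s * \<psi> s + \<psi> e * \<psi> c + \<psi> (2 * s) * \<psi> (e + c)"
proof -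
  define X where "X n = real n * 2 ^ s - real s * 2 ^ n" for n
  \<comment> \<open>Both bounds are rearrangements of
    \<open>pow2_plus_one_ratio_mono\<close>.\<close>
  have X: "n \<le> s \<Longrightarrow> real s - real n \<le> X n" "s \<le> n \<Longrightarrow> real n - real s \<le> - X n" if "2 \<le> n" for n
    using pow2_plus_one_ratio_mono[of n s] pow2_plus_one_ratio_mono[of s n] that assms(1)
    by (auto simp: X_def algebra_simps)
  have *: "(real s - real e) * (real s - real c) \<le> X e * X c"
    using assms(4)
  proof
    assume "e \<le> s \<and> c \<le> s"
    then show ?thesis using X[OF assms(2)] X[OF assms(3)] by (intro mult_mono) auto
  next
    assume "s \<le> e \<and> s \<le> c"
    then have "(real e - real s) * (real c - real s) \<le> (- X e) * (- X c)"
      using X[OF assms(2)] X[OF assms(3)] by (intro mult_mono) (auto intro: order_trans[rotated])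
    then show ?thesis by (simp add: algebra_simps)
  qed
  have "\<psi> s * \<psi> s + \<psi> e * \<psi> c + \<psi> (2 * s) * \<psi> (e + c)
      - (\<psi> s * \<psi> e + \<psi> s * \<psi> c + \<psi> (s + e) * \<psi> (s + c))
      = (X e * X c - (real s - real e) * (real s - real c)) / 2 ^ (2 * s + e + c)"
    unfolding mult_2[of s] by (simp add: \<psi>_def X_def power_add field_simps)
  also have "\<dots> \<ge> 0" using * by simp
  finally show ?thesis by simp
qed

section \<open>Exchange inequalities for pairs of subtrees\<close>

text \<open>The bounds are those of the theorem: 2^k + 2^(k-1) is half of 3 * 2^k, which explains
  the doubled \<open>m\<close>, and 2^k + 2^(k+1) is 3 * 2^k.\<close>

definition opt :: "nat \<Rightarrow> bool" where
  "opt m \<longleftrightarrow> (\<forall>k. 3 * 2 ^ k \<le> 2 * m \<and> m < 3 * 2 ^ k \<longrightarrow> val m = split_val (2 ^ k) (m - 2 ^ k))"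

lemma optD: "opt m \<Longrightarrow> s = 2 ^ k \<Longrightarrow> 3 * s \<le> 2 * m \<Longrightarrow> m < 3 * s \<Longrightarrow>
    val m = split_val s (m - s)"
  by (auto simp: opt_def)

text \<open>The split \<open>x\<close>, \<open>y\<close> is no better than the optimal one at
  \<open>u\<close>. For a fixed sum the term \<psi> \<psi> grows with the product of the parts, so
  the less balanced pair has the smaller term and must make up for it in \<open>val\<close>.\<close>

lemma val_exchange:
  assumes "val (x + y) = split_val u (x + y - u)" "u \<le> x \<and> u \<le> y \<or> x \<le> u \<and> y \<le> u"
    "1 \<le> x" "1 \<le> y" "u \<le> x + y"
  shows "val x + val y \<le> val u + val (x + y - u)"
proof -
  have "0 \<le> (real x - real u) * (real y - real u)"
    using assms(2) by (auto intro: mult_nonpos_nonpos)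
  then have "real u * (real x + real y - real u) \<le> real x * real y"
    by (simp add: algebra_simps)
  then have "\<psi> u * \<psi> (x + y - u) \<le> \<psi> x * \<psi> y"
    using assms(5) by (simp add: \<psi>_mult divide_right_mono)
  moreover have "split_val x y \<le> split_val u (x + y - u)"
    using split_val_le[of x y] assms by simp
  ultimately show ?thesis by (simp add: split_val_def)
qed

text \<open>Exchange turns the pair \<open>x\<close>, \<open>y\<close> into \<open>t\<close> and
  \<open>x + y - t\<close>, directly or by way of \<open>2 * t\<close>, which then breaks up as
  \<open>t + t\<close>. Along the way \<open>\<psi> t * \<psi> y\<close> is replaced by
  \<open>\<psi> t * \<psi> z\<close> with \<open>z < y\<close>; the summand with
  \<open>(y - 2) / 2 ^ y\<close> records this surplus, which later pays for losses higher up in the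
  tree.\<close>

lemma val_pair_le:
  assumes t: "t = 2 ^ k" and opt: "opt (x + y)" "opt (2 * t)"
    and xy: "t \<le> x" "x < 2 * t" "t < y" "y < 2 * t"
  shows "val x + val y + 2 * \<psi> t * \<psi> y + 2 * \<psi> t * ((real y - 2) / 2 ^ y)
    \<le> val t + val (x + y - t) + 2 * \<psi> t * \<psi> t"
proof -
  have t1: "1 \<le> t" by (simp add: t)
  \<comment> \<open>Here \<open>z\<close> will be \<open>t\<close> if \<open>x + y < 3 * t\<close>,
    and \<open>x + y - 2 * t\<close> otherwise.\<close>
  have gap: "2 * \<psi> t * \<psi> y + 2 * \<psi> t * ((real y - 2) / 2 ^ y) \<le> 2 * \<psi> t * \<psi> z"
    if "1 \<le> z" "z < y" for z
  proof -
    have "2 * \<psi> t * (\<psi> y + (real y - 2) / 2 ^ y) \<le> 2 * \<psi> t * \<psi> z"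
      using \<psi>_gap[OF that] by (intro mult_left_mono) auto
    then show ?thesis by (simp add: algebra_simps)
  qed
  show ?thesis
  proof (cases "x + y < 3 * t")
    case True
    then have "val x + val y \<le> val t + val (x + y - t)"
      using xy t1 by (intro val_exchange optD[OF opt(1) t]) auto
    then show ?thesis using gap[of t] xy t1 by linarith
  next
    case False
    have "val x + val y \<le> val (2 * t) + val (x + y - 2 * t)"
      using xy t1 False by (intro val_exchange optD[OF opt(1), of _ "Suc k"]) (auto simp: t)
    also have "val (2 * t) = 2 * val t + 2 * \<psi> t * \<psi> t"
      using optD[OF opt(2) t] t1 by (simp add: split_val_def)
    finally have "val x + val y \<le> 2 * val t + 2 * \<psi> t * \<psi> t + val (x + y - 2 * t)" .
    moreover have "val t + val (x + y - 2 * t) + 2 * \<psi> t * \<psi> (x + y - 2 * t) \<le> val (x + y - t)"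
      using split_val_le[of t "x + y - 2 * t"] xy t1 False by (simp add: split_val_def)
    ultimately show ?thesis using gap[of "x + y - 2 * t"] xy t1 False by linarith
  qed
qed

text \<open>The surplus of \<open>val_pair_le\<close> covers a merge of \<open>2 * t\<close> with
  \<open>e\<close>. With \<open>e = t + x\<close> and \<open>y = 2 * t - d\<close> the powers of two
  cancel, and the claim follows from \<open>t + x \<le> t * 2 ^ x\<close> and
  \<open>2 * t \<le> (y - 2) * 2 ^ d\<close>.\<close>

lemma gap_estimate:
  assumes "4 \<le> t" "t \<le> e" "e < 2 * t" "t < y" "y < 2 * t"
  shows "\<psi> (2 * t) * \<psi> e \<le> \<psi> t * ((real y - 2) / 2 ^ y)"
proof -
  define x where "x = e - t"
  define d where "d = 2 * t - y"
  have e: "e = t + x" and y: "y = 2 * t - d" and d: "1 \<le> d" "d < t"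
    using assms by (auto simp: x_def d_def)
  have A: "real t + real x \<le> real t * 2 ^ x"
  proof -
    have "1 + real x \<le> 2 ^ x" using Bernoulli_inequality[of 1 x] by simp
    then have "real t * (1 + real x) \<le> real t * 2 ^ x" by (intro mult_left_mono) auto
    moreover have "1 * real x \<le> real t * real x" using assms(1) by (intro mult_right_mono) auto
    ultimately show ?thesis by (simp add: algebra_simps)
  qed
  have B: "2 * real t \<le> (2 * real t - real d - 2) * 2 ^ d"
  proof (cases "d = 1")
    case True
    then show ?thesis using assms(1) by simp
  next
    case False
    then have "(2::real) ^ 2 \<le> 2 ^ d" using d by (intro power_increasing) auto
    then have "(2 * real t - real d - 2) * 4 \<le> (2 * real t - real d - 2) * 2 ^ d"
      using d assms(1) by (intro mult_left_mono) auto
    moreover have "2 * real t \<le> (2 * real t - real d - 2) * 4"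
      using d assms(1) by (simp add: algebra_simps)
    ultimately show ?thesis by linarith
  qed
  have "2 * real e * 2 ^ y \<le> 2 * (real t * 2 ^ x) * 2 ^ y"
    using A by (simp add: e)
  also have "\<dots> = 2 * real t * (2 ^ x * 2 ^ y)" by simp
  also have "\<dots> \<le> (2 * real t - real d - 2) * 2 ^ d * (2 ^ x * 2 ^ y)"
    using B by (intro mult_right_mono) auto
  also have "\<dots> = (real y - 2) * (2 ^ d * 2 ^ y * 2 ^ x)" using d by (simp add: y)
  also have "2 ^ d * 2 ^ y * 2 ^ x = (2::real) ^ (t + e)"
    using d by (simp add: y e flip: power_add)
  finally have "2 * real e * 2 ^ y \<le> (real y - 2) * 2 ^ (t + e)" .
  then have "real t * (2 * real e * 2 ^ y) \<le> real t * ((real y - 2) * 2 ^ (t + e))"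
    by (intro mult_left_mono) auto
  then show ?thesis
    unfolding mult_2[of t] by (simp add: \<psi>_def power_add field_simps)
qed

text \<open>Opening \<open>a = t + y\<close>, \<open>val_pair_le\<close> exchanges \<open>e\<close>
  and \<open>y\<close> for \<open>t\<close> and \<open>e + y - t\<close>. The two copies of
  \<open>t\<close> then merge into \<open>2 * t\<close>, and the surplus pays for the term with
  \<open>\<psi> (2 * t) * \<psi> e\<close>.\<close>

lemma val_pair_le':
  assumes t: "t = 2 ^ k" "4 \<le> t" and opt: "opt (e + a - t)" "opt (2 * t)" "opt a"
    and ea: "t \<le> e" "e < 2 * t" "2 * t < a" "a < 3 * t"
  shows "val e + val a + 2 * \<psi> (2 * t) * \<psi> e \<le> val (2 * t) + val (e + a - 2 * t)"
proof -
  define y where "y = a - t"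
  have y: "a = t + y" "t < y" "y < 2 * t" using ea by (auto simp: y_def)
  have eay: "e + a - 2 * t = e + y - t" using y by auto
  have "val a = val t + val y + 2 * \<psi> t * \<psi> y"
    using optD[OF opt(3) t(1)] ea y by (simp add: split_val_def)
  moreover have "val e + val y + 2 * \<psi> t * \<psi> y + 2 * \<psi> t * ((real y - 2) / 2 ^ y)
      \<le> val t + val (e + y - t) + 2 * \<psi> t * \<psi> t"
    using opt y ea by (intro val_pair_le[OF t(1)]) auto
  moreover have "2 * val t + 2 * \<psi> t * \<psi> t \<le> val (2 * t)"
    using val_double_ge t(2) by simp
  moreover have "\<psi> (2 * t) * \<psi> e \<le> \<psi> t * ((real y - 2) / 2 ^ y)"
    using gap_estimate[of t e y] t(2) ea y by simp
  ultimately show ?thesis unfolding eay by linarith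
qed

section \<open>The power of two belonging to \<open>m\<close>\<close>

lemma scale_exists:
  fixes m :: nat
  assumes "2 \<le> m" obtains k where "3 * 2 ^ k \<le> 2 * m" "m < 3 * 2 ^ k"
proof -
  have ex: "m < 3 * 2 ^ m" using less_exp[of m] by linarith
  define k where "k = (LEAST k. m < 3 * 2 ^ k)"
  have k: "m < 3 * 2 ^ k" unfolding k_def using ex by (rule LeastI)
  have "3 * 2 ^ k \<le> 2 * m"
  proof (cases k)
    case 0
    then show ?thesis using assms by simp
  next
    case (Suc j)
    then have "\<not> m < 3 * 2 ^ j" using not_less_Least[of j "\<lambda>k. m < 3 * 2 ^ k"] by (auto simp: k_def)
    then show ?thesis using Suc by simp
  qed
  with k show ?thesis using that by blast
qed

lemma scale_unique:
  fixes m :: nat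
  assumes "3 * 2 ^ k \<le> 2 * m" "m < 3 * 2 ^ k" "3 * 2 ^ j \<le> 2 * m" "m < 3 * 2 ^ j"
  shows "k = j"
proof -
  have *: "\<not> i < l" if "3 * 2 ^ l \<le> 2 * m" "m < 3 * 2 ^ i" for i l :: nat
  proof
    assume "i < l"
    then have "(2::nat) ^ Suc i \<le> 2 ^ l" by (intro power_increasing) auto
    then show False using that by simp
  qed
  show ?thesis using *[of k j] *[of j k] assms by linarith
qed

section \<open>The induction step: moving a power of two to the root\<close>

text \<open>Once \<open>m\<close> reaches \<open>3 * s\<close>, the right power is
  \<open>2 * s\<close>. Then \<open>m - s\<close> itself splits as \<open>s + r\<close>, and
  rotating s + (s + r) into (s + s) + r brings \<open>2 * s\<close> to the root, since
  \<open>r\<close> is the largest of the three parts.\<close>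

lemma split_pow2_le:
  assumes s: "s = 2 ^ j" and opt: "3 * s \<le> m \<Longrightarrow> opt (m - s)" and m: "3 * s \<le> 2 * m" "m < 4 * s"
  shows "\<exists>k. 3 * 2 ^ k \<le> 2 * m \<and> m < 3 * 2 ^ k \<and> split_val s (m - s) \<le> split_val (2 ^ k) (m - 2 ^ k)"
proof (cases "m < 3 * s")
  case True
  then show ?thesis using s m by auto
next
  case False
  define r where "r = m - 2 * s"
  have r: "m = 2 * s + r" "s \<le> r" "r < 2 * s" using False m by (auto simp: r_def)
  have s1: "1 \<le> s" using s by simp
  have ms: "m - s = s + r" using r by simp
  have "val (s + r) = split_val s (s + r - s)"
    using optD[OF opt s] False m ms by simp
  then have "split_val s (m - s) = 2 * val s + val r + 2 * (\<psi> r * \<psi> s + \<psi> s * \<psi> (r + s))"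
    unfolding ms by (simp add: split_val_def algebra_simps)
  also have "\<dots> \<le> 2 * val s + val r + 2 * (\<psi> s * \<psi> s + \<psi> r * \<psi> (s + s))"
    using \<psi>_rotate[OF s1 r(2), of s] by simp
  also have "\<dots> \<le> val (s + s) + val r + 2 * \<psi> r * \<psi> (s + s)"
    using split_val_le[OF s1 s1] by (simp add: split_val_def)
  also have "\<dots> = split_val (s + s) r"
    by (simp add: split_val_def)
  also have "s + s = 2 ^ Suc j" by (simp add: s)
  also have "r = m - 2 ^ Suc j" by (simp add: s r_def)
  finally show ?thesis using False m s by (intro exI[of _ "Suc j"]) auto
qed

text \<open>The larger part is opened as \<open>b = s + c\<close>, so the tree is a + (s + c). The
  positions of \<open>a\<close> and \<open>c\<close> relative to \<open>s\<close> decide whether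
  \<open>s\<close> or \<open>2 * s\<close> is brought to the root, and \<open>via_s\<close> and
  \<open>via_2s\<close> finish from there.\<close>

lemma split_val_le_pow2:
  assumes m: "24 \<le> m" and IH: "\<And>n. 6 < n \<Longrightarrow> n < m \<Longrightarrow> opt n"
    and ab: "1 \<le> a" "a \<le> b" "a + b = m"
  shows "\<exists>k. 3 * 2 ^ k \<le> 2 * m \<and> m < 3 * 2 ^ k \<and> split_val a b \<le> split_val (2 ^ k) (m - 2 ^ k)"
proof -
  obtain j where j: "3 * 2 ^ j \<le> 2 * b" "b < 3 * 2 ^ j"
    using scale_exists[of b] m ab by auto
  \<comment> \<open>From \<open>m \<ge> 24\<close> follows \<open>b \<ge> 12\<close>, hence
    \<open>s \<ge> 8\<close> and \<open>t \<ge> 4\<close>; this also keeps the sizes to which the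
    induction hypothesis is applied above the exception 6.\<close>
  have "2 < j"
  proof (rule ccontr)
    assume "\<not> 2 < j"
    then have "(2::nat) ^ j \<le> 2 ^ 2" by (intro power_increasing) auto
    then show False using j m ab by simp
  qed
  then obtain i where i: "j = Suc i" "2 \<le> i" by (cases j) auto
  define t :: nat where "t = 2 ^ i"
  define s :: nat where "s = 2 * t"
  define c where "c = b - s"
  have s: "s = 2 ^ j" by (simp add: s_def t_def i)
  have t4: "4 \<le> t" using power_increasing[OF i(2), of "2::nat"] by (simp add: t_def)
  have s8: "8 \<le> s" using t4 by (simp add: s_def)
  have b: "b = s + c" and c: "t \<le> c" "c < 2 * s"
    using j unfolding c_def s[symmetric] by (auto simp: s_def)
  have m_eq: "m = a + s + c" using ab b by simp
  have valb: "val b = val s + val c + 2 * \<psi> s * \<psi> c"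
    using optD[OF IH s, of b] j m ab by (auto simp: split_val_def b s[symmetric])
  have split: "split_val a b = val a + val s + val c + 2 * (\<psi> s * \<psi> c + \<psi> a * \<psi> (s + c))"
    by (simp add: split_val_def valb) (simp add: b algebra_simps)
  have via_s: ?thesis if "split_val a b \<le> split_val s (a + c)" "m < 4 * s"
  proof -
    have "3 * s \<le> m \<Longrightarrow> opt (m - s)" using t4 s_def m by (intro IH) auto
    moreover have "3 * s \<le> 2 * m" using m_eq c ab(1) s_def by linarith
    ultimately have "\<exists>k. 3 * 2 ^ k \<le> 2 * m \<and> m < 3 * 2 ^ k \<and>
        split_val s (m - s) \<le> split_val (2 ^ k) (m - 2 ^ k)"
      using that(2) by (intro split_pow2_le[OF s])
    moreover have "m - s = a + c" using m_eq by simp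
    ultimately show ?thesis using that(1) order_trans by metis
  qed
  have via_2s: ?thesis if "split_val a b \<le> split_val (2 * s) (m - 2 * s)" "3 * s \<le> m" "m < 6 * s"
    using that s by (intro exI[of _ "Suc j"]) auto
  \<comment> \<open>Here \<open>a\<close> has the same power \<open>s\<close> as \<open>b\<close>,
    so the tree (s + e) + (s + c) can be turned into (s + s) + (e + c).\<close>
  have regroup: "split_val a b \<le> split_val (2 * s) (m - 2 * s)"
    if "3 * t \<le> a" "a < 2 * s \<and> c < s \<or> 2 * s \<le> a"
  proof -
    define e where "e = a - s"
    with that b ab have e: "a = s + e" "e \<le> c" "t \<le> e" by (auto simp: s_def)
    have "opt a" using e t4 s_def m_eq by (intro IH) auto
    moreover have "3 * s \<le> 2 * a" "a < 3 * s" using that e c by (auto simp: s_def)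
    ultimately have "val a = split_val s (a - s)" by (intro optD[OF _ s])
    then have "val a = val s + val e + 2 * \<psi> s * \<psi> e"
      by (simp add: split_val_def e_def)
    moreover have "2 * val s + 2 * \<psi> s * \<psi> s \<le> val (2 * s)"
      using val_double_ge s8 by simp
    moreover have "val e + val c + 2 * \<psi> e * \<psi> c \<le> val (e + c)"
      using split_val_le[of e c] t4 e c by (simp add: split_val_def)
    moreover have "\<psi> s * \<psi> e + \<psi> s * \<psi> c + \<psi> (s + e) * \<psi> (s + c)
        \<le> \<psi> s * \<psi> s + \<psi> e * \<psi> c + \<psi> (2 * s) * \<psi> (e + c)"
      using that t4 e c by (intro \<psi>_regroup) (auto simp: s_def)
    moreover have "m - 2 * s = e + c" using m_eq e by simp
    ultimately show ?thesis unfolding split by (simp add: split_val_def e(1))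
  qed
  consider "a \<le> s" | "s < a" "a < 2 * s" "c = s" | "s < a" "a < 2 * s" "s < c"
    | "s < a" "a < 3 * t" "c < s" | "3 * t \<le> a" "a < 2 * s" "c < s" | "2 * s \<le> a"
    by (cases "a \<le> s"; cases "a < 2 * s"; cases "c = s"; cases "s < c"; cases "a < 3 * t") simp_all
  then show ?thesis
  proof cases
    case 1
    \<comment> \<open>Rotate a + (s + c) into s + (a + c), then replace \<open>a + c\<close> by its
      best split.\<close>
    have "split_val a b \<le> val a + val s + val c + 2 * (\<psi> a * \<psi> c + \<psi> s * \<psi> (a + c))"
      using \<psi>_rotate[OF ab(1) 1, of c] by (simp add: split)
    also have "\<dots> \<le> split_val s (a + c)"
      using split_val_le[of a c] ab c t4 by (simp add: split_val_def)
    finally show ?thesis by (rule via_s) (use 1 c m_eq in linarith)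
  next
    case 2
    \<comment> \<open>The larger part is already the required power of two.\<close>
    then have "b = 2 * s" "a = m - 2 * s" using b m_eq by auto
    then have "split_val a b = split_val (2 * s) (m - 2 * s)"
      using split_val_commute by blast
    then show ?thesis by (intro via_2s) (use 2 m_eq s8 in linarith)+
  next
    case 3
    \<comment> \<open>The pair \<open>a\<close>, \<open>c\<close> is exchanged for \<open>s\<close>
      and \<open>a + c - s\<close>, and the two copies of \<open>s\<close> merge. The surplus
      \<open>G\<close> alone pays for the old root term; the new root term is only used as
      nonnegative.\<close>
    define G where "G = \<psi> s * ((real c - 2) / 2 ^ c)"
    have "a + c < m" "2 * s < m" using m_eq 3 t4 s_def by auto
    then have "val a + val c + 2 * \<psi> s * \<psi> c + 2 * G
        \<le> val s + val (a + c - s) + 2 * \<psi> s * \<psi> s"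
      using 3 c s8 val_pair_le[OF s IH IH, of a c] by (simp add: G_def)
    moreover have "2 * val s + 2 * \<psi> s * \<psi> s \<le> val (2 * s)"
      using val_double_ge s8 by simp
    moreover have "\<psi> a * \<psi> (s + c) \<le> G"
    proof -
      have "real a \<le> 2 ^ a" using less_imp_le[OF less_exp[of a]] by (simp flip: of_nat_le_iff)
      moreover have "real s + real c \<le> real s * (real c - 2)"
      proof -
        have "0 \<le> (real s - 4) * (real c - 4)" using 3 t4 s_def by simp
        then have "4 * real s + 4 * real c - 16 \<le> real s * real c" by (simp add: algebra_simps)
        moreover have "8 \<le> real s" "8 \<le> real c" using 3 t4 s_def by auto
        ultimately show ?thesis unfolding right_diff_distrib by linarith
      qed
      ultimately have "real a * (real s + real c) \<le> 2 ^ a * (real s * (real c - 2))"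
        by (intro mult_mono) auto
      then have "real a * (real s + real c) / 2 ^ (a + s + c)
          \<le> 2 ^ a * (real s * (real c - 2)) / 2 ^ (a + s + c)"
        by (intro divide_right_mono) auto
      then show ?thesis by (simp add: G_def \<psi>_def power_add)
    qed
    moreover have "0 \<le> \<psi> (2 * s) * \<psi> (a + c - s)" by simp
    ultimately have "split_val a b \<le> val (2 * s) + val (a + c - s) + 2 * (\<psi> (2 * s) * \<psi> (a + c - s))"
      unfolding split mult.assoc distrib_left by linarith
    also have "a + c - s = m - 2 * s" using m_eq 3 by linarith
    also have "val (2 * s) + val (m - 2 * s) + 2 * (\<psi> (2 * s) * \<psi> (m - 2 * s))
        = split_val (2 * s) (m - 2 * s)"
      by (simp add: split_val_def)
    finally show ?thesis by (rule via_2s) (use 3 m_eq c in linarith)+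
  next
    case 4
    \<comment> \<open>Exchange turns \<open>a\<close>, \<open>c\<close> into \<open>s\<close> and
      \<open>c + a - s\<close>, which are then merged again into \<open>a + c\<close>. This merge
      gains \<open>\<psi> s * \<psi> (c + a - s)\<close>, enough for the loss at the root when
      \<open>a\<close> is replaced there by \<open>s\<close>.\<close>
    have "c + a - t < m" "2 * t < m" "a < m" using m_eq 4 t4 s_def by auto
    then have "val c + val a + 2 * \<psi> s * \<psi> c \<le> val s + val (c + a - s)"
      using 4 c t4 unfolding s_def by (intro val_pair_le'[OF t_def] IH) auto
    moreover have "val s + val (c + a - s) + 2 * \<psi> s * \<psi> (c + a - s) \<le> val (a + c)"
      using split_val_le[of s "c + a - s"] 4 c t4 s_def by (simp add: split_val_def ac_simps)
    moreover have "\<psi> a * \<psi> (s + c) \<le> \<psi> s * \<psi> (a + c) + \<psi> s * \<psi> (c + a - s)"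
    proof -
      have "\<psi> a * \<psi> (s + c) - \<psi> s * \<psi> (a + c) = real (c * (a - s)) / 2 ^ (a + s + c)"
        using 4 by (simp add: \<psi>_mult ac_simps) (simp add: field_simps)
      also have "\<dots> \<le> real (s * (c + a - s)) / 2 ^ (s + (c + a - s))"
        using 4 by (intro frac_le power_increasing of_nat_mono mult_mono) auto
      also have "\<dots> = \<psi> s * \<psi> (c + a - s)" by (simp only: \<psi>_mult)
      finally show ?thesis by simp
    qed
    ultimately have "split_val a b \<le> split_val s (a + c)"
      unfolding split by (simp add: split_val_def)
    then show ?thesis by (rule via_s) (use 4 m_eq s_def in linarith)
  next
    case 5
    then have "split_val a b \<le> split_val (2 * s) (m - 2 * s)" by (intro regroup) (auto simp: s_def)
    \<comment> \<open>The bound \<open>3 * s \<le> m\<close> comes from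
      \<open>m \<ge> 2 * a \<ge> 6 * t\<close>.\<close>
    then show ?thesis by (rule via_2s) (use 5 m_eq ab b c s_def in linarith)+
  next
    case 6
    then have "split_val a b \<le> split_val (2 * s) (m - 2 * s)" by (intro regroup) (auto simp: s_def)
    then show ?thesis by (rule via_2s) (use 6 m_eq ab b c s_def in linarith)+
  qed
qed

section \<open>The values below 24\<close>

lemma W_eq_Max_list:
  assumes "2 \<le> m"
  shows "W m = Max (set (map (\<lambda>a. 2 ^ (m - a) * W a + 2 ^ a * W (m - a) + a * (m - a)) (1 # [2..<m])))"
proof -
  have "{1..<m} = insert 1 {2..<m}" using assms by auto
  then show ?thesis using W_rec[OF assms] by simp
qed

lemma W_values:
  "W 2 = 1" "W 3 = 4" "W 4 = 12" "W 5 = 30" "W 6 = 73" "W 7 = 172" "W 8 = 400" "W 9 = 884" "W 10 = 1960" "W 11 = 4316" "W 12 = 9504" "W 13 = 20520" "W 14 = 44336" "W 15 = 95288" "W 16 = 204864" "W 17 = 431176" "W 18 = 911440" "W 19 = 1924184" "W 20 = 4071520" "W 21 = 8530024" "W 22 = 17903728" "W 23 = 37501048"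
proof -
  show W2: "W 2 = 1"
    by (subst W_eq_Max_list) simp_all
  show W3: "W 3 = 4"
    by (subst W_eq_Max_list) (simp_all add: W2)
  show W4: "W 4 = 12"
    by (subst W_eq_Max_list) (simp_all add: W2 W3)
  show W5: "W 5 = 30"
    by (subst W_eq_Max_list) (simp_all add: W2 W3 W4)
  show W6: "W 6 = 73"
    by (subst W_eq_Max_list) (simp_all add: W2 W3 W4 W5)
  show W7: "W 7 = 172"
    by (subst W_eq_Max_list) (simp_all add: W2 W3 W4 W5 W6)
  show W8: "W 8 = 400"
    by (subst W_eq_Max_list) (simp_all add: W2 W3 W4 W5 W6 W7)
  show W9: "W 9 = 884"
    by (subst W_eq_Max_list) (simp_all add: W2 W3 W4 W5 W6 W7 W8)
  show W10: "W 10 = 1960"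
    by (subst W_eq_Max_list) (simp_all add: W2 W3 W4 W5 W6 W7 W8 W9)
  show W11: "W 11 = 4316"
    by (subst W_eq_Max_list) (simp_all add: W2 W3 W4 W5 W6 W7 W8 W9 W10)
  show W12: "W 12 = 9504"
    by (subst W_eq_Max_list) (simp_all add: W2 W3 W4 W5 W6 W7 W8 W9 W10 W11)
  show W13: "W 13 = 20520"
    by (subst W_eq_Max_list) (simp_all add: W2 W3 W4 W5 W6 W7 W8 W9 W10 W11 W12)
  show W14: "W 14 = 44336"
    by (subst W_eq_Max_list) (simp_all add: W2 W3 W4 W5 W6 W7 W8 W9 W10 W11 W12 W13)
  show W15: "W 15 = 95288"
    by (subst W_eq_Max_list) (simp_all add: W2 W3 W4 W5 W6 W7 W8 W9 W10 W11 W12 W13 W14)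
  show W16: "W 16 = 204864"
    by (subst W_eq_Max_list) (simp_all add: W2 W3 W4 W5 W6 W7 W8 W9 W10 W11 W12 W13 W14 W15)
  show W17: "W 17 = 431176"
    by (subst W_eq_Max_list) (simp_all add: W2 W3 W4 W5 W6 W7 W8 W9 W10 W11 W12 W13 W14 W15 W16)
  show W18: "W 18 = 911440"
    by (subst W_eq_Max_list) (simp_all add: W2 W3 W4 W5 W6 W7 W8 W9 W10 W11 W12 W13 W14 W15 W16 W17)
  show W19: "W 19 = 1924184"
    by (subst W_eq_Max_list) (simp_all add: W2 W3 W4 W5 W6 W7 W8 W9 W10 W11 W12 W13 W14 W15 W16 W17 W18)
  show W20: "W 20 = 4071520"
    by (subst W_eq_Max_list) (simp_all add: W2 W3 W4 W5 W6 W7 W8 W9 W10 W11 W12 W13 W14 W15 W16 W17 W18 W19)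
  show W21: "W 21 = 8530024"
    by (subst W_eq_Max_list) (simp_all add: W2 W3 W4 W5 W6 W7 W8 W9 W10 W11 W12 W13 W14 W15 W16 W17 W18 W19 W20)
  show W22: "W 22 = 17903728"
    by (subst W_eq_Max_list) (simp_all add: W2 W3 W4 W5 W6 W7 W8 W9 W10 W11 W12 W13 W14 W15 W16 W17 W18 W19 W20 W21)
  show W23: "W 23 = 37501048"
    by (subst W_eq_Max_list) (simp_all add: W2 W3 W4 W5 W6 W7 W8 W9 W10 W11 W12 W13 W14 W15 W16 W17 W18 W19 W20 W21 W22)
qed

text \<open>Comparison with the computed table. At 6 the split 3 + 3 gives 73 and beats 4 + 2 with
  72, which is the exception of the theorem.\<close>

lemma opt_base:
  assumes "2 \<le> m" "m \<noteq> 6" "m < 24"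
  shows "opt m"
  unfolding opt_def
proof (intro allI impI)
  fix k :: nat assume k: "3 * 2 ^ k \<le> 2 * m \<and> m < 3 * 2 ^ k"
  have "k < 4"
  proof (rule ccontr)
    assume "\<not> k < 4"
    then have "(2::nat) ^ 4 \<le> 2 ^ k" by (intro power_increasing) auto
    then show False using k assms by simp
  qed
  then have "k \<in> {0, 1, 2, 3}" by auto
  moreover have "m \<in> {2, 3, 4, 5, 6, 7, 8, 9, 10, 11, 12, 13, 14, 15, 16, 17, 18, 19, 20, 21, 22, 23}"
    using assms by simp presburger
  ultimately have "W m = 2 ^ (m - 2 ^ k) * W (2 ^ k) + 2 ^ (2 ^ k) * W (m - 2 ^ k) + 2 ^ k * (m - 2 ^ k)"
    using k assms(2) by (auto simp: W_values)
  moreover have "2 ^ k \<le> m" using k by simp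
  ultimately show "val m = split_val (2 ^ k) (m - 2 ^ k)"
    unfolding split_val_eq val_def by simp
qed

lemma opt_all:
  assumes "2 \<le> m" "m \<noteq> 6"
  shows "opt m"
  using assms
proof (induction m rule: less_induct)
  case (less m)
  show ?case
  proof (cases "m < 24")
    case True
    then show ?thesis using less.prems by (intro opt_base)
  next
    case False
    obtain a b where ab: "1 \<le> a" "a \<le> b" "a + b = m" "val m = split_val a b"
      using split_val_attained less.prems(1) by blast
    \<comment> \<open>Restricting to sizes above 6 keeps the exception out of the induction.\<close>
    have IH: "\<And>n. 6 < n \<Longrightarrow> n < m \<Longrightarrow> opt n" using less.IH by simp
    obtain k where k: "3 * 2 ^ k \<le> 2 * m" "m < 3 * 2 ^ k"
        "val m \<le> split_val (2 ^ k) (m - 2 ^ k)"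
      using split_val_le_pow2[OF _ IH ab(1-3)] False ab(4) by auto
    then have "split_val (2 ^ k) (m - 2 ^ k) \<le> val m"
      using split_val_le[of "2 ^ k" "m - 2 ^ k"] by (simp add: Suc_le_eq)
    with k have "val m = split_val (2 ^ k) (m - 2 ^ k)" by simp
    then show ?thesis using scale_unique[OF k(1,2)] by (auto simp: opt_def)
  qed
qed

section \<open>Return to \<open>h2\<close> and to integer exponents\<close>

lemma h2_eq_val:
  assumes "1 \<le> m" shows "h2 m = val m / real m"
proof -
  have "(2::real) ^ m = 2 * 2 ^ (m - 1)" using assms by (simp flip: power_Suc)
  then show ?thesis using assms by (simp add: h2_def val_def H2_eq_W)
qed

lemma powi_scale_iff:
  fixes k :: int and m :: nat
  assumes "2 \<le> m"
  shows "2 powi k + 2 powi (k - 1) \<le> real m \<and> real m < 2 powi k + 2 powi (k + 1) \<longleftrightarrow>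
    0 \<le> k \<and> 3 * 2 ^ nat k \<le> 2 * m \<and> m < 3 * 2 ^ nat k"
proof (cases "0 \<le> k")
  case True
  define n where "n = nat k"
  have k: "k = int n" using True by (simp add: n_def)
  have "2 powi k = (2::real) ^ n" "2 powi (k - 1) = (2::real) ^ n / 2"
      "2 powi (k + 1) = 2 * (2::real) ^ n"
    by (simp_all add: k power_int_diff power_int_add)
  moreover have "(3 * 2 ^ n \<le> 2 * m) = (real (3 * 2 ^ n) \<le> real (2 * m))"
    by (simp only: of_nat_le_iff)
  moreover have "(m < 3 * 2 ^ n) = (real m < real (3 * 2 ^ n))"
    by (simp only: of_nat_less_iff)
  ultimately show ?thesis using True unfolding n_def[symmetric] by auto
next
  case False
  \<comment> \<open>For negative \<open>k\<close> the upper bound on \<open>m\<close> is at most 1/2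
    + 1, below 2.\<close>
  have "2 powi k \<le> (2::real) powi (- 1)" "2 powi (k + 1) \<le> (2::real) powi 0"
    using False by (intro power_int_increasing; simp)+
  then have "2 powi k + 2 powi (k + 1) < (2::real)" by simp
  then show ?thesis using False assms by simp
qed

theorem theorem5p4:
  fixes m :: nat
  assumes "m \<ge> 2" and "m \<noteq> 6"
  shows "(\<exists>!k::int. 2 powi k + 2 powi (k - 1) \<le> real m \<and> real m < 2 powi k + 2 powi (k + 1)) \<and>
    (\<forall>k::int. 2 powi k + 2 powi (k - 1) \<le> real m \<and> real m < 2 powi k + 2 powi (k + 1) \<longrightarrow>
      k \<ge> 0 \<and>
      h2 m = 2 ^ nat k * h2 (2 ^ nat k) / real m
           + (real m - 2 ^ nat k) * h2 (m - 2 ^ nat k) / real m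
           + 2 ^ nat k * (real m - 2 ^ nat k) / (real m * 2 ^ (m - 1)))"
proof -
  obtain n where n: "3 * 2 ^ n \<le> 2 * m" "m < 3 * 2 ^ n"
    using scale_exists[OF assms(1)] .
  define s :: nat where "s = 2 ^ n"
  have uniq: "k = int n" if "0 \<le> k" "3 * 2 ^ nat k \<le> 2 * m" "m < 3 * 2 ^ nat k" for k
    using scale_unique[OF that(2,3) n] that(1) by simp
  have s: "1 \<le> s" "s < m" "1 \<le> m - s" using n assms(1) by (auto simp: s_def)
  have "val m = val s + val (m - s) + 2 * (\<psi> s * \<psi> (m - s))"
    using opt_all[OF assms] n by (simp add: opt_def split_val_def s_def)
  also have "2 * (\<psi> s * \<psi> (m - s)) = real s * (real m - real s) / 2 ^ (m - 1)"
  proof -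
    have "(2::real) ^ m = 2 * 2 ^ (m - 1)" using assms(1) by (simp flip: power_Suc)
    then show ?thesis using s by (simp add: \<psi>_mult)
  qed
  also have "val s = real s * h2 s" using s by (simp add: h2_eq_val)
  also have "val (m - s) = (real m - real s) * h2 (m - s)"
    using s by (simp add: h2_eq_val)
  finally have "h2 m = real s * h2 s / real m + (real m - real s) * h2 (m - s) / real m
      + real s * (real m - real s) / (real m * 2 ^ (m - 1))"
    using assms(1) by (simp add: h2_eq_val add_divide_distrib)
  then have eq: "h2 m = 2 ^ n * h2 (2 ^ n) / real m + (real m - 2 ^ n) * h2 (m - 2 ^ n) / real m
      + 2 ^ n * (real m - 2 ^ n) / (real m * 2 ^ (m - 1))"
    by (simp add: s_def)
  show ?thesis
    unfolding powi_scale_iff[OF assms(1)]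
  proof (intro conjI allI impI)
    show "\<exists>!k. 0 \<le> k \<and> 3 * 2 ^ nat k \<le> 2 * m \<and> m < 3 * 2 ^ nat k"
      using n uniq by (intro ex1I[of _ "int n"]) auto
  next
    fix k assume k: "0 \<le> k \<and> 3 * 2 ^ nat k \<le> 2 * m \<and> m < 3 * 2 ^ nat k"
    then show "0 \<le> k" by simp
    have "nat k = n" using uniq[of k] k by simp
    with eq show "h2 m = 2 ^ nat k * h2 (2 ^ nat k) / real m
        + (real m - 2 ^ nat k) * h2 (m - 2 ^ nat k) / real m
        + 2 ^ nat k * (real m - 2 ^ nat k) / (real m * 2 ^ (m - 1))"
      by simp
  qed
qed

end
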